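(* Let $p,q\ge 0$ with $p+q=1$ and $q\ne0$, let $\tau=p/q$, let $0<\rho\le1$, and let $k\ge1$ be an integer. Then, as an identity of rational functions in the variables $\xi_1,\ldots,\xi_k$, $$\sum_{\sigma\in\mathbb{S}_k}\operatorname{sgn}\sigma\;\prod_{1\le i<j\le k}\frac{1}{p+q\,\xi_{\sigma(i)}\xi_{\sigma(j)}-\xi_{\sigma(i)}}\;\prod_{i=1}^{k}\frac{1}{\xi_{\sigma(i)}\xi_{\sigma(i+1)}\cdots\xi_{\sigma(k)}-1+\rho-\tau^{k-i+1}\rho}$$ $$=\;q^{k(k-1)/2}\,\frac{\prod_{1\le i<j\le k}(\xi_i-\xi_j)}{\prod_{i=1}^k\big(\xi_i-1+\rho(1-\tau)\big)\;\prod_{i\neq j}\,(p+q\,\xi_i\xi_j-\xi_i)},$$ where the last product is over all ordered pairs $(i,j)$ with $1\le i,j\le k$, $i\ne j$.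
   Context: $\mathbb{S}_k$ is the symmetric group on $\{1,\ldots,k\}$ and $\operatorname{sgn}\sigma$ the sign of the permutation $\sigma$. *)

theory Defs
  imports
    Complex_Main
    "HOL-Library.Poly_Mapping"
    "HOL-Computational_Algebra.Fraction_Field"
    "HOL-Combinatorics.Permutations"
begin

text \<open>
  Multivariate polynomials over the reals in variables indexed by the natural numbers
  (finitely supported maps from monomials to coefficients, monomials being finitely
  supported exponent functions), and their field of fractions.
  The functions in finitely many of the variables form a subfield.
\<close>

type_synonym rpoly = "(nat \<Rightarrow>\<^sub>0 nat) \<Rightarrow>\<^sub>0 real"

type_synonym rfun = "rpoly fract"

definition rconst :: "real \<Rightarrow> rfun" where
  "rconst c = Fract (Poly_Mapping.single 0 c) 1"

definition rvar :: "nat \<Rightarrow> rfun" where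
  "rvar i = Fract (Poly_Mapping.single (Poly_Mapping.single i 1) 1) 1"

end

theory Submission
  imports Defs "HOL-Computational_Algebra.Polynomial"
begin

text \<open>
  The factor with \<open>i = 1\<close> of the last product is symmetric in the variables, so conditioning on
  \<open>\<sigma>(1) = b\<close> gives an induction on the number of variables. After division by the
  antisymmetric right-hand side, the induction step is the identity
  \<open>\<Sum>\<^sub>b (\<xi>\<^sub>b - c) \<Prod>\<^bsub>i \<noteq> b\<^esub> (p + q \<xi>\<^sub>i \<xi>\<^sub>b - \<xi>\<^sub>i) / (\<xi>\<^sub>b - \<xi>\<^sub>i) = q\<^bsup>k-1\<^esup> (\<xi>\<^sub>1 \<dots> \<xi>\<^sub>k - 1 + \<rho> - \<tau>\<^sup>k \<rho>)\<close>
  with \<open>c = 1 - \<rho> (1 - \<tau>)\<close>.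
  Its summands are \<open>E(\<xi>\<^sub>b) / \<Prod>\<^bsub>i \<noteq> b\<^esub> (\<xi>\<^sub>b - \<xi>\<^sub>i)\<close> for a polynomial \<open>E\<close>
  of degree less than \<open>k\<close>, namely the quotient of
  \<open>(z - c) \<Prod>\<^sub>i (p + q \<xi>\<^sub>i z - \<xi>\<^sub>i) - (\<alpha> z + \<beta>) \<Prod>\<^sub>i (z - \<xi>\<^sub>i)\<close> by \<open>q z\<^sup>2 - z + p\<close>
  for suitable \<open>\<alpha>, \<beta>\<close>, so by Lagrange interpolation they sum to
  the coefficient of \<open>z\<^bsup>k-1\<^esup>\<close> in \<open>E\<close>.
\<close>

section \<open>Lagrange interpolation and the identity behind the induction step\<close>

lemma degree_coeff_prod_linear:
  fixes x :: "'i \<Rightarrow> 'a::idom"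
  assumes "finite S"
  shows "degree (\<Prod>i\<in>S. [:- x i, 1:]) = card S" "coeff (\<Prod>i\<in>S. [:- x i, 1:]) (card S) = 1"
proof -
  show *: "degree (\<Prod>i\<in>S. [:- x i, 1:]) = card S"
    using assms by (subst degree_prod_sum_eq) auto
  have "lead_coeff (\<Prod>i\<in>S. [:- x i, 1:]) = 1"
    by (simp add: lead_coeff_prod)
  then show "coeff (\<Prod>i\<in>S. [:- x i, 1:]) (card S) = 1"
    by (simp only: *)
qed

text \<open>A polynomial of degree less than \<open>card S\<close> equals its Lagrange interpolant
  at the nodes \<open>x m\<close>. The numerator of each basis polynomial is monic of degree
  \<open>card S - 1\<close>, so the top coefficient of the interpolant is the sum of its
  weights.\<close>

lemma sum_lagrange_top_coeff:
  fixes x :: "'i \<Rightarrow> 'a::field" and E :: "'a poly"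
  assumes "finite S" "S \<noteq> {}" "inj_on x S" "degree E < card S"
  shows "(\<Sum>m\<in>S. poly E (x m) / (\<Prod>i\<in>S-{m}. x m - x i)) = coeff E (card S - 1)"
proof -
  define c where "c m = poly E (x m) / (\<Prod>i\<in>S-{m}. x m - x i)" for m
  define L where "L = (\<Sum>m\<in>S. smult (c m) (\<Prod>i\<in>S-{m}. [:- x i, 1:]))"
  have pos: "card S > 0" using assms by (simp add: card_gt_0_iff)
  have deg: "degree (\<Prod>i\<in>S-{m}. [:- x i, 1:]) = card S - 1" if "m \<in> S" for m
    using that assms by (subst degree_coeff_prod_linear) auto
  have "poly E z = poly L z" if z: "z \<in> x ` S" for z
  proof -
    obtain n where n: "n \<in> S" "z = x n" using z by blast
    have "poly L z = (\<Sum>m\<in>S. c m * (\<Prod>i\<in>S-{m}. x n - x i))"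
      by (simp add: L_def poly_sum poly_prod n)
    \<comment> \<open>For \<open>m\<close> different from \<open>n\<close> the product contains the
      zero factor \<open>x n - x n\<close>.\<close>
    also have "\<dots> = (\<Sum>m\<in>{n}. c m * (\<Prod>i\<in>S-{m}. x n - x i))"
      using n assms(1) by (intro sum.mono_neutral_right) auto
    also have "\<dots> = poly E z"
      using n assms(1,3) by (auto simp: c_def inj_on_def)
    finally show ?thesis by simp
  qed
  moreover have "degree L < card S"
    unfolding L_def using pos deg
    by (intro degree_sum_less) (auto intro: le_less_trans[OF degree_smult_le])
  ultimately have "E = L"
    using assms by (intro poly_eqI_degree[of "x ` S"]) (auto simp: card_image)
  have "coeff L (card S - 1) = (\<Sum>m\<in>S. c m)"
    unfolding L_def coeff_sum
  proof (rule sum.cong)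
    fix m assume "m \<in> S"
    then have "card S - 1 = card (S - {m})" using assms by simp
    then show "coeff (smult (c m) (\<Prod>i\<in>S-{m}. [:- x i, 1:])) (card S - 1) = c m"
      using assms by (simp add: degree_coeff_prod_linear)
  qed simp
  then show ?thesis by (simp add: \<open>E = L\<close> c_def)
qed

text \<open>
  Modulo \<open>q z\<^sup>2 - z + p\<close> one has \<open>p - x + q x z \<equiv> (1 - q z) (z - x)\<close>, and the linear
  polynomials \<open>\<alpha> z + \<beta>\<close> below are the remainders of \<open>(z - c) (1 - q z)\<^sup>k\<close>.
  Unlike interpolation at the roots \<open>1\<close> and \<open>p / q\<close>, this also covers \<open>p = q\<close>.
\<close>
lemma remainder_quotient:
  fixes x :: "'i \<Rightarrow> 'a::field" and p q \<rho> :: 'a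
  assumes "finite S" "p + q = 1" "q \<noteq> 0"
  defines "\<alpha> \<equiv> \<lambda>k::nat. q ^ k + \<rho> * (p ^ k - q ^ k)"
  defines "\<beta> \<equiv> \<lambda>k::nat. - \<alpha> (Suc k) / q"
  shows "\<exists>E. (\<forall>i\<ge>card S. coeff E i = 0)
    \<and> q * coeff E (card S - 1) = q ^ card S * (\<Prod>i\<in>S. x i) - \<alpha> (card S)
    \<and> (\<forall>z. (z - 1 + \<rho> * (1 - p / q)) * (\<Prod>i\<in>S. p + q * x i * z - x i)
           = (\<alpha> (card S) * z + \<beta> (card S)) * (\<Prod>i\<in>S. z - x i) + (p + q * z * z - z) * poly E z)"
  using assms(1)
proof (induction S rule: finite_induct)
  case empty
  have "z - 1 + \<rho> * (1 - p / q) = \<alpha> 0 * z + \<beta> 0" for z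
    using assms(3) by (simp add: \<alpha>_def \<beta>_def field_simps)
  then show ?case
    by (intro exI[of _ 0]) (simp add: \<alpha>_def)
next
  case (insert a S)
  define k where "k = card S"
  define W where "W = (\<Prod>i\<in>S. [:- x i, 1:])"
  from insert.IH obtain E where E: "\<And>i. i \<ge> k \<Longrightarrow> coeff E i = 0"
    "q * coeff E (k - 1) = q ^ k * (\<Prod>i\<in>S. x i) - \<alpha> k"
    "\<And>z. (z - 1 + \<rho> * (1 - p / q)) * (\<Prod>i\<in>S. p + q * x i * z - x i)
           = (\<alpha> k * z + \<beta> k) * (\<Prod>i\<in>S. z - x i) + (p + q * z * z - z) * poly E z"
    unfolding k_def by blast
  have p: "p = 1 - q" using assms(2) by (simp add: algebra_simps)
  have \<alpha>': "\<alpha> (Suc k) = - q * \<beta> k"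
    using assms(3) by (simp add: \<beta>_def)
  \<comment> \<open>Since \<open>p + q = 1\<close>, both \<open>p\<close> and \<open>q\<close> are
    roots of \<open>t^2 - t + p * q\<close>, and \<open>\<alpha> k\<close> is a linear combination
    of \<open>p ^ k\<close> and \<open>q ^ k\<close>.\<close>
  have "\<alpha> (Suc (Suc k)) = \<alpha> (Suc k) - p * q * \<alpha> k"
    unfolding \<alpha>_def p by (simp add: algebra_simps)
  then have \<beta>': "\<beta> (Suc k) = \<beta> k + p * \<alpha> k"
    using assms(3) by (simp add: \<beta>_def field_simps)
  \<comment> \<open>Multiplying the hypothesis by \<open>p + q * x a * z - x a\<close> turns
    \<open>E\<close> into the second summand. The first one is the quotient left over from \<open>(p
    + q * x a * z - x a) * (\<alpha> k * z + \<beta> k) - (\<alpha> (Suc k) * z + \<beta> (Suc k)) *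
    (z - x a) = (\<alpha> k * x a + \<beta> k) * (q * z * z - z + p)\<close>.\<close>
  define E' where "E' = smult (\<alpha> k * x a + \<beta> k) W + [:p - x a, q * x a:] * E"
  have card: "card (insert a S) = Suc k"
    using insert.hyps by (simp add: k_def)
  have W: "degree W = k" "coeff W k = 1"
    unfolding W_def k_def using degree_coeff_prod_linear insert.hyps by auto
  show ?case unfolding card
  proof (intro exI[of _ E'] conjI allI impI)
    fix i assume i: "i \<ge> Suc k"
    then have "coeff W i = 0" "coeff E i = 0" "coeff E (i - 1) = 0"
      using E(1) W by (auto intro: coeff_eq_0)
    then show "coeff E' i = 0"
      using i by (cases i) (simp_all add: E'_def)
  next
    \<comment> \<open>For \<open>k = 0\<close> the truncated index \<open>k - 1\<close> is 0, and
      \<open>coeff E 0 = 0\<close> makes the formula hold there too.\<close>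
    have "coeff E' k = \<alpha> k * x a + \<beta> k + q * x a * coeff E (k - 1)"
      by (cases k) (use W E(1)[of k] E(1)[of 0] in \<open>simp_all add: E'_def\<close>)
    then have "q * coeff E' k = q * (\<alpha> k * x a + \<beta> k) + q * x a * (q * coeff E (k - 1))"
      by (simp add: algebra_simps)
    also have "\<dots> = q ^ Suc k * (x a * (\<Prod>i\<in>S. x i)) - \<alpha> (Suc k)"
      unfolding E(2) \<alpha>' by (simp add: algebra_simps)
    finally show "q * coeff E' (Suc k - 1) = q ^ Suc k * (\<Prod>i\<in>insert a S. x i) - \<alpha> (Suc k)"
      using insert.hyps by simp
  next
    fix z
    define w where "w = (\<Prod>i\<in>S. z - x i)"
    have W': "poly W z = w" by (simp add: W_def w_def poly_prod)
    have "(z - 1 + \<rho> * (1 - p / q)) * (\<Prod>i\<in>insert a S. p + q * x i * z - x i)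
      = (p + q * x a * z - x a) * ((z - 1 + \<rho> * (1 - p / q)) * (\<Prod>i\<in>S. p + q * x i * z - x i))"
      using insert.hyps by (simp add: mult.left_commute)
    also have "\<dots> = (p + q * x a * z - x a) * ((\<alpha> k * z + \<beta> k) * w + (p + q * z * z - z) * poly E z)"
      unfolding E(3) w_def ..
    also have "\<dots> = (\<alpha> (Suc k) * z + \<beta> (Suc k)) * ((z - x a) * w) + (p + q * z * z - z) * poly E' z"
      unfolding \<alpha>' \<beta>' E'_def by (simp add: W' algebra_simps)
    finally show "(z - 1 + \<rho> * (1 - p / q)) * (\<Prod>i\<in>insert a S. p + q * x i * z - x i)
      = (\<alpha> (Suc k) * z + \<beta> (Suc k)) * (\<Prod>i\<in>insert a S. z - x i) + (p + q * z * z - z) * poly E' z"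
      using insert.hyps by (simp add: w_def)
  qed
qed

text \<open>This evaluates the sum over the value taken by a permutation at the first index. The
  quotient \<open>E\<close> supplies the numerators at the nodes, where \<open>nz\<close> allows
  division by the quadratic, and its top coefficient is the right-hand side.\<close>

lemma sum_interpolation_identity:
  fixes x :: "'i \<Rightarrow> 'a::field" and p q \<rho> :: 'a
  assumes "finite S" "S \<noteq> {}" "inj_on x S" "p + q = 1" "q \<noteq> 0"
    and nz: "\<And>m. m \<in> S \<Longrightarrow> p + q * x m * x m - x m \<noteq> 0"
  shows "(\<Sum>m\<in>S. (x m - 1 + \<rho> * (1 - p / q))
            * (\<Prod>i\<in>S-{m}. p + q * x i * x m - x i) / (\<Prod>i\<in>S-{m}. x m - x i))
         = q ^ (card S - 1) * ((\<Prod>i\<in>S. x i) - 1 + \<rho> - (p / q) ^ card S * \<rho>)"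
proof -
  define k where "k = card S"
  have k: "k > 0" using assms by (simp add: k_def card_gt_0_iff)
  from remainder_quotient[OF assms(1,4,5), of x \<rho>] obtain E \<alpha> \<beta> where E:
    "\<And>i. i \<ge> k \<Longrightarrow> coeff E i = 0"
    "q * coeff E (k - 1) = q ^ k * (\<Prod>i\<in>S. x i) - (q ^ k + \<rho> * (p ^ k - q ^ k))"
    "\<And>z. (z - 1 + \<rho> * (1 - p / q)) * (\<Prod>i\<in>S. p + q * x i * z - x i)
      = (\<alpha> * z + \<beta>) * (\<Prod>i\<in>S. z - x i) + (p + q * z * z - z) * poly E z"
    unfolding k_def by blast
  \<comment> \<open>At \<open>z = x m\<close> the remainder term vanishes, and the factor
    \<open>i = m\<close> of the product on the left is exactly the value of the quadratic, so it
    cancels.\<close>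
  have "poly E (x m) = (x m - 1 + \<rho> * (1 - p / q)) * (\<Prod>i\<in>S-{m}. p + q * x i * x m - x i)"
    if "m \<in> S" for m
  proof -
    have "(p + q * x m * x m - x m) * poly E (x m)
      = (x m - 1 + \<rho> * (1 - p / q)) * (\<Prod>i\<in>S. p + q * x i * x m - x i)"
      unfolding E(3) using that assms(1) by auto
    also have "\<dots> = (p + q * x m * x m - x m)
      * ((x m - 1 + \<rho> * (1 - p / q)) * (\<Prod>i\<in>S-{m}. p + q * x i * x m - x i))"
      using that assms(1) by (subst prod.remove[of S m]) (auto simp: mult.left_commute)
    finally show ?thesis using nz[OF that] by simp
  qed
  moreover have "degree E < k"
    using E(1) k by (intro degree_lessI) auto
  ultimately have "(\<Sum>m\<in>S. (x m - 1 + \<rho> * (1 - p / q))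
            * (\<Prod>i\<in>S-{m}. p + q * x i * x m - x i) / (\<Prod>i\<in>S-{m}. x m - x i)) = coeff E (k - 1)"
    using sum_lagrange_top_coeff[OF assms(1-3), of E] by (simp add: k_def)
  also have "\<dots> = q ^ (k - 1) * ((\<Prod>i\<in>S. x i) - 1 + \<rho> - (p / q) ^ k * \<rho>)"
  proof -
    have qk: "q ^ k = q * q ^ (k - 1)" using k by (simp add: power_eq_if)
    have "q * (q ^ (k - 1) * ((\<Prod>i\<in>S. x i) - 1 + \<rho> - (p / q) ^ k * \<rho>))
      = q ^ k * (\<Prod>i\<in>S. x i) - q ^ k + q ^ k * \<rho> - q ^ k * (p / q) ^ k * \<rho>"
      unfolding qk by (simp add: algebra_simps)
    also have "q ^ k * (p / q) ^ k = p ^ k"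
      using assms(5) by (simp flip: power_mult_distrib)
    also have "q ^ k * (\<Prod>i\<in>S. x i) - q ^ k + q ^ k * \<rho> - p ^ k * \<rho> = q * coeff E (k - 1)"
      unfolding E(2) by (simp add: algebra_simps)
    finally show ?thesis using assms(5) by simp
  qed
  finally show ?thesis by (simp add: k_def)
qed

section \<open>Products over pairs of indices and the sign of the Vandermonde product\<close>

lemma prod_ordered_pairs_Suc:
  fixes h :: "nat \<Rightarrow> nat \<Rightarrow> 'a::comm_monoid_mult"
  shows "(\<Prod>(i, j) \<in> {(i, j). a \<le> i \<and> i < j \<and> j \<le> k}. h i j)
    = (\<Prod>j=Suc a..k. h a j) * (\<Prod>(i, j) \<in> {(i, j). Suc a \<le> i \<and> i < j \<and> j \<le> k}. h i j)"
proof -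
  let ?P = "\<lambda>a. {(i, j). a \<le> i \<and> i < j \<and> j \<le> k}"
  have fin: "finite (?P (Suc a))"
    by (rule finite_subset[of _ "{..k} \<times> {..k}"]) auto
  have eq: "?P a = Pair a ` {Suc a..k} \<union> ?P (Suc a)"
    by (auto simp: image_iff)
  show ?thesis unfolding eq
    by (subst prod.union_disjoint) (use fin in \<open>auto simp: prod.reindex inj_on_def\<close>)
qed

text \<open>Swapping neighbours preserves the order within every pair except
  \<open>(b, Suc b)\<close>, so the other factors are merely permuted and this one changes
  sign.\<close>

lemma vandermonde_transpose_Suc:
  fixes x :: "nat \<Rightarrow> 'a::comm_ring_1"
  assumes "a \<le> b" "Suc b \<le> k"
  shows "(\<Prod>(i, j) \<in> {(i, j). a \<le> i \<and> i < j \<and> j \<le> k}.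
            x (transpose b (Suc b) i) - x (transpose b (Suc b) j))
    = - (\<Prod>(i, j) \<in> {(i, j). a \<le> i \<and> i < j \<and> j \<le> k}. x i - x j)"
proof -
  let ?P = "{(i, j). a \<le> i \<and> i < j \<and> j \<le> k}"
  let ?t = "transpose b (Suc b)"
  have fin: "finite ?P"
    by (rule finite_subset[of _ "{..k} \<times> {..k}"]) auto
  have mem: "(b, Suc b) \<in> ?P" using assms by auto
  have "(\<Prod>(i, j)\<in>?P-{(b, Suc b)}. x (?t i) - x (?t j)) = (\<Prod>(i, j)\<in>?P-{(b, Suc b)}. x i - x j)"
    by (rule prod.reindex_bij_witness[where i = "map_prod ?t ?t" and j = "map_prod ?t ?t"])
      (use assms in \<open>auto simp: Transposition.transpose_def split: if_splits\<close>)
  then show ?thesis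
    using fin mem by (simp add: prod.remove[of ?P "(b, Suc b)"] algebra_simps)
qed

lemma vandermonde_transpose:
  fixes x :: "nat \<Rightarrow> 'a::comm_ring_1"
  assumes "a \<le> b" "b < c" "c \<le> k"
  shows "(\<Prod>(i, j) \<in> {(i, j). a \<le> i \<and> i < j \<and> j \<le> k}. x (transpose b c i) - x (transpose b c j))
    = - (\<Prod>(i, j) \<in> {(i, j). a \<le> i \<and> i < j \<and> j \<le> k}. x i - x j)"
  using assms(2,3)
proof (induction c arbitrary: x rule: less_induct)
  case (less c)
  define V where "V = (\<lambda>y :: nat \<Rightarrow> 'a. \<Prod>(i, j) \<in> {(i, j). a \<le> i \<and> i < j \<and> j \<le> k}. y i - y j)"
  obtain d where d: "c = Suc d" using less.prems by (cases c) auto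
  have adj: "V (y \<circ> transpose d c) = - V y" for y
    using vandermonde_transpose_Suc[of a d k y] less.prems assms(1) by (simp add: V_def d)
  have "V (x \<circ> transpose b c) = - V x"
  proof (cases "b = d")
    case True
    then show ?thesis using adj by simp
  next
    case False
    have IH: "V (y \<circ> transpose b d) = - V y" for y
      using less.IH[of d y] less.prems False by (simp add: V_def d)
    \<comment> \<open>Conjugation by the neighbour swap of \<open>d\<close> and \<open>c\<close>
      reduces to a shorter transposition; the three sign changes multiply to -1.\<close>
    have "transpose b c = transpose d c \<circ> transpose b d \<circ> transpose d c"
      using False less.prems by (auto simp: fun_eq_iff Transposition.transpose_def d)
    then have "V (x \<circ> transpose b c) = V (((x \<circ> transpose d c) \<circ> transpose b d) \<circ> transpose d c)"
      by (simp add: comp_assoc)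
    also have "\<dots> = - V x" by (simp only: adj IH minus_minus)
    finally show ?thesis .
  qed
  then show ?case by (simp add: V_def)
qed

lemma prod_offdiag_remove:
  fixes h :: "'i \<Rightarrow> 'i \<Rightarrow> 'a::comm_monoid_mult"
  assumes "finite T" "b \<in> T"
  shows "(\<Prod>(i, j) \<in> {(i, j). i \<in> T \<and> j \<in> T \<and> i \<noteq> j}. h i j)
    = (\<Prod>j\<in>T-{b}. h b j) * (\<Prod>i\<in>T-{b}. h i b)
      * (\<Prod>(i, j) \<in> {(i, j). i \<in> T-{b} \<and> j \<in> T-{b} \<and> i \<noteq> j}. h i j)"
proof -
  let ?O = "\<lambda>T. {(i, j). i \<in> T \<and> j \<in> T \<and> i \<noteq> j}"
  have fin: "finite (?O (T-{b}))"
    by (rule finite_subset[of _ "T \<times> T"]) (use assms in auto)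
  have eq: "?O T = (Pair b ` (T-{b}) \<union> (\<lambda>i. (i, b)) ` (T-{b})) \<union> ?O (T-{b})"
    using assms by auto
  show ?thesis unfolding eq using fin assms
    by (subst prod.union_disjoint; (subst prod.union_disjoint)?)
      (auto simp: prod.reindex inj_on_def)
qed

lemma transpose_bij_betw_remove:
  assumes "a \<notin> S" "b \<in> insert a S"
  shows "bij_betw (transpose a b) S (insert a S - {b})"
  by (rule bij_betwI[where g = "transpose a b"])
    (use assms in \<open>auto simp: Transposition.transpose_def split: if_splits\<close>)

lemma prod_offdiag_reindex:
  fixes h :: "'i \<Rightarrow> 'i \<Rightarrow> 'a::comm_monoid_mult"
  assumes "bij_betw t S T"
  shows "(\<Prod>(i, j) \<in> {(i, j). i \<in> S \<and> j \<in> S \<and> i \<noteq> j}. h (t i) (t j))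
    = (\<Prod>(i, j) \<in> {(i, j). i \<in> T \<and> j \<in> T \<and> i \<noteq> j}. h i j)"
proof -
  have inj: "inj_on t S" and T: "T = t ` S"
    using assms by (auto simp: bij_betw_def)
  have "{(i, j). i \<in> T \<and> j \<in> T \<and> i \<noteq> j} = map_prod t t ` {(i, j). i \<in> S \<and> j \<in> S \<and> i \<noteq> j}"
    using inj by (force simp: T inj_on_def)
  moreover have "inj_on (map_prod t t) {(i, j). i \<in> S \<and> j \<in> S \<and> i \<noteq> j}"
    using inj by (auto simp: inj_on_def)
  ultimately show ?thesis
    by (simp add: prod.reindex case_prod_beta)
qed

section \<open>The antisymmetrized identity over an arbitrary field\<close>

text \<open>The induction lowers \<open>a\<close> from \<open>Suc k\<close>, where both sides are 1,
  and enlarges the index range. The values \<open>x\<close> stay arbitrary because the hypothesis is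
  applied to relabelled variables; the nonvanishing condition ranges over all subsets because any of
  the variables may be the ones that remain.\<close>

lemma antisymmetrized_product_identity:
  fixes x :: "nat \<Rightarrow> 'a::field" and p q \<rho> :: 'a and a k :: nat
  assumes "p + q = 1" "q \<noteq> 0" "a \<le> Suc k" "inj_on x {a..k}"
    and "\<And>i j. i \<in> {a..k} \<Longrightarrow> j \<in> {a..k} \<Longrightarrow> p + q * x i * x j - x i \<noteq> 0"
    and "\<And>A. A \<subseteq> {a..k} \<Longrightarrow> A \<noteq> {} \<Longrightarrow> (\<Prod>l\<in>A. x l) - 1 + \<rho> - (p / q) ^ card A * \<rho> \<noteq> 0"
  shows "(\<Sum>\<sigma> | \<sigma> permutes {a..k}.
        of_int (sign \<sigma>)
        * (\<Prod>(i, j) \<in> {(i, j). a \<le> i \<and> i < j \<and> j \<le> k}.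
             1 / (p + q * x (\<sigma> i) * x (\<sigma> j) - x (\<sigma> i)))
        * (\<Prod>i = a..k. 1 / ((\<Prod>l = i..k. x (\<sigma> l)) - 1 + \<rho> - (p / q) ^ (k - i + 1) * \<rho>)))
     = q ^ ((Suc k - a) * (k - a) div 2)
       * (\<Prod>(i, j) \<in> {(i, j). a \<le> i \<and> i < j \<and> j \<le> k}. x i - x j)
       / ((\<Prod>i = a..k. x i - 1 + \<rho> * (1 - p / q))
          * (\<Prod>(i, j) \<in> {(i, j). i \<in> {a..k} \<and> j \<in> {a..k} \<and> i \<noteq> j}. p + q * x i * x j - x i))"
  using assms(3-)
proof (induction a arbitrary: x rule: inc_induct)
  case base
  have empty: "{(i, j). Suc k \<le> i \<and> i < j \<and> j \<le> k} = {}" by auto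
  show ?case unfolding empty by simp
next
  case (step a)
  define S where "S = {Suc a..k}"
  define T where "T = {a..k}"
  define g where "g u v = p + q * u * v - u" for u v :: 'a
  \<comment> \<open>The denominator of the factor \<open>i = a\<close>, which is the same for every
    permutation of \<open>T\<close>.\<close>
  define \<Gamma> where "\<Gamma> = (\<Prod>l\<in>T. x l) - 1 + \<rho> - (p / q) ^ card T * \<rho>"
  define P where "P = (\<lambda>a. {(i, j). a \<le> i \<and> i < j \<and> j \<le> k})"
  define V where "V = (\<lambda>a (y :: nat \<Rightarrow> 'a). \<Prod>(i, j)\<in>P a. y i - y j)"
  define D where "D = (\<lambda>T. \<Prod>i\<in>T. x i - 1 + \<rho> * (1 - p / q))"
  define Q where "Q = (\<lambda>T. \<Prod>(i, j) \<in> {(i, j). i \<in> T \<and> j \<in> T \<and> i \<noteq> j}. g (x i) (x j))"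
  define F where "F = (\<lambda>a y \<sigma>. of_int (sign \<sigma>)
        * (\<Prod>(i, j) \<in> P a. 1 / g (y (\<sigma> i)) (y (\<sigma> j)))
        * (\<Prod>i = a..k. 1 / ((\<Prod>l = i..k. y (\<sigma> l)) - 1 + \<rho> - (p / q) ^ (k - i + 1) * \<rho>)))"
  define e where "e = (k - a) * (k - Suc a) div 2"
  have ak: "a \<le> k" using step.hyps by simp
  have T: "T = insert a S" "a \<notin> S" "finite S" "finite T" "T \<noteq> {}"
    using ak by (auto simp: S_def T_def)
  have cardT: "card T = Suc (k - a)" using ak by (simp add: T_def)
  have inj: "inj_on x T" using step.prems(1) by (simp add: T_def)
  have gnz: "g (x i) (x j) \<noteq> 0" if "i \<in> T" "j \<in> T" for i j
    using step.prems(2) that by (simp add: T_def g_def)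
  have \<Gamma>: "\<Gamma> \<noteq> 0" using step.prems(3)[of T] T(5) by (simp add: T_def \<Gamma>_def)
  \<comment> \<open>This is the subset condition for a singleton.\<close>
  have cnz: "x i - 1 + \<rho> * (1 - p / q) \<noteq> 0" if "i \<in> T" for i
    using step.prems(3)[of "{i}"] that by (simp add: T_def algebra_simps)
  have Dnz: "D U \<noteq> 0" if "U \<subseteq> T" for U
    using cnz that finite_subset[OF that T(4)] by (auto simp: D_def)
  have Qnz: "Q U \<noteq> 0" if "U \<subseteq> T" for U
  proof -
    have "finite {(i, j). i \<in> U \<and> j \<in> U \<and> i \<noteq> j}"
      by (rule finite_subset[of _ "T \<times> T"]) (use T(4) that in auto)
    then show ?thesis using gnz that by (auto simp: Q_def)
  qed

  \<comment> \<open>The permutations of \<open>T\<close> sending \<open>a\<close> to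
    \<open>b\<close> are the composites \<open>transpose a b \<circ> \<sigma>\<close> with
    \<open>\<sigma>\<close> permuting \<open>S\<close>. Their contribution is written with a
    prefactor independent of \<open>b\<close>, which leaves a summand of the interpolation
    identity.\<close>
  have summand: "(\<Sum>\<sigma> | \<sigma> permutes S. F a x (transpose a b \<circ> \<sigma>))
      = q ^ e * V a x / (\<Gamma> * D T * Q T)
        * ((x b - 1 + \<rho> * (1 - p / q)) * (\<Prod>i\<in>T-{b}. p + q * x i * x b - x i) / (\<Prod>i\<in>T-{b}. x b - x i))"
    if b: "b \<in> T" for b
  proof -
    define t where "t = transpose a b"
    \<comment> \<open>On \<open>S\<close> the values of \<open>y\<close> are those of
      \<open>x\<close> on \<open>T - {b}\<close>, so the induction hypothesis applies with its
      interval of indices unchanged.\<close>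
    define y where "y = x \<circ> t"
    define G where "G = (\<Prod>j\<in>T-{b}. g (x b) (x j))"
    have bij: "bij_betw t S (T - {b})"
      using transpose_bij_betw_remove[of a S b] T b by (simp add: t_def)
    then have t_img: "t i \<in> T - {b}" if "i \<in> S" for i
      using that by (auto simp: bij_betw_def)
    have t_inj: "inj_on t U" for U
      using inj_on_subset[OF bij_is_inj[OF bij_transpose]] by (simp add: t_def)
    have ta: "t a = b" by (simp add: t_def)
    have tT: "t permutes T"
      using b T unfolding t_def by (intro permutes_swap_id) auto
    \<comment> \<open>The pairs \<open>(a, j)\<close> contribute \<open>1 / G\<close>, since
      \<open>\<sigma>\<close> fixes \<open>a\<close> and \<open>t\<close> sends it to
      \<open>b\<close>; the factor \<open>i = a\<close> contributes
      \<open>1 / \<Gamma>\<close>.\<close>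
    have summand': "F a x (t \<circ> \<sigma>) = of_int (sign t) / (G * \<Gamma>) * F (Suc a) y \<sigma>" if \<sigma>: "\<sigma> permutes S" for \<sigma>
    proof -
      have \<sigma>T: "\<sigma> permutes T" using \<sigma> T by (metis permutes_subset subset_insertI)
      have "sign (t \<circ> \<sigma>) = sign t * sign \<sigma>"
        using \<sigma>T tT T(4) by (intro sign_compose) (auto intro: permutes_imp_permutation)
      moreover have "(\<Prod>(i, j) \<in> P a. 1 / g (x ((t \<circ> \<sigma>) i)) (x ((t \<circ> \<sigma>) j)))
        = 1 / G * (\<Prod>(i, j) \<in> P (Suc a). 1 / g (y (\<sigma> i)) (y (\<sigma> j)))"
      proof -
        have "\<sigma> a = a" using \<sigma> T(2) by (simp add: permutes_not_in)
        then have "(\<Prod>j=Suc a..k. 1 / g (x ((t \<circ> \<sigma>) a)) (x ((t \<circ> \<sigma>) j)))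
          = (\<Prod>j\<in>S. 1 / g (x b) (y (\<sigma> j)))"
          by (simp add: ta S_def y_def)
        also have "\<dots> = (\<Prod>j\<in>S. 1 / g (x b) (x (t j)))"
          using prod.permute[OF \<sigma>, of "\<lambda>j. 1 / g (x b) (y j)"] by (simp add: y_def o_def)
        also have "\<dots> = (\<Prod>j\<in>T-{b}. 1 / g (x b) (x j))"
          by (rule prod.reindex_bij_betw[OF bij])
        also have "\<dots> = 1 / G" by (simp add: G_def prod_dividef)
        finally show ?thesis unfolding P_def
          by (subst prod_ordered_pairs_Suc) (simp add: y_def)
      qed
      moreover have "(\<Prod>i = a..k. 1 / ((\<Prod>l = i..k. x ((t \<circ> \<sigma>) l)) - 1 + \<rho> - (p / q) ^ (k - i + 1) * \<rho>))
        = 1 / \<Gamma> * (\<Prod>i = Suc a..k. 1 / ((\<Prod>l = i..k. y (\<sigma> l)) - 1 + \<rho> - (p / q) ^ (k - i + 1) * \<rho>))"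
      proof -
        have "(\<Prod>l=a..k. x (t (\<sigma> l))) = (\<Prod>l\<in>T. x l)"
          using prod.permute[OF permutes_compose[OF \<sigma>T tT], of x] by (simp add: T_def o_def)
        moreover have "k - a + 1 = card T" by (simp add: cardT)
        ultimately show ?thesis
          by (subst prod.atLeast_Suc_atMost[OF ak]) (simp only: \<Gamma>_def y_def o_apply)
      qed
      ultimately show ?thesis
        by (simp only: F_def of_int_mult) simp
    qed
    have "(\<Sum>\<sigma> | \<sigma> permutes S. F (Suc a) y \<sigma>)
      = q ^ e * V (Suc a) y / ((\<Prod>i\<in>S. y i - 1 + \<rho> * (1 - p / q))
          * (\<Prod>(i, j) \<in> {(i, j). i \<in> S \<and> j \<in> S \<and> i \<noteq> j}. g (y i) (y j)))"
      unfolding F_def P_def V_def S_def g_def e_def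
    proof (subst step.IH)
      show "inj_on y {Suc a..k}"
        unfolding y_def using inj t_img t_inj
        by (intro comp_inj_on) (auto simp: S_def intro: inj_on_subset)
      show "p + q * y i * y j - y i \<noteq> 0" if "i \<in> {Suc a..k}" "j \<in> {Suc a..k}" for i j
        using gnz[of "t i" "t j"] t_img that by (simp add: y_def g_def S_def)
      show "(\<Prod>l\<in>A. y l) - 1 + \<rho> - (p / q) ^ card A * \<rho> \<noteq> 0" if "A \<subseteq> {Suc a..k}" "A \<noteq> {}" for A
      proof -
        have "t ` A \<subseteq> {a..k}"
          using t_img that(1) unfolding S_def T_def by blast
        then show ?thesis
          using step.prems(3)[of "t ` A"] that(2)
          by (simp add: y_def prod.reindex[OF t_inj] card_image[OF t_inj])
      qed
    qed (simp_all add: mult.commute)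
    also have "(\<Prod>i\<in>S. y i - 1 + \<rho> * (1 - p / q)) = D (T - {b})"
      unfolding D_def y_def o_def by (rule prod.reindex_bij_betw[OF bij])
    also have "(\<Prod>(i, j) \<in> {(i, j). i \<in> S \<and> j \<in> S \<and> i \<noteq> j}. g (y i) (y j)) = Q (T - {b})"
      unfolding Q_def y_def o_def by (rule prod_offdiag_reindex[OF bij])
    finally have IH: "(\<Sum>\<sigma> | \<sigma> permutes S. F (Suc a) y \<sigma>)
      = q ^ e * V (Suc a) y / (D (T - {b}) * Q (T - {b}))" .
    define R where "R = (\<Prod>i\<in>T-{b}. x b - x i)"
    define H where "H = (\<Prod>i\<in>T-{b}. g (x i) (x b))"
    have Rnz: "R \<noteq> 0" using inj b T(4) by (auto simp: R_def inj_on_def)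
    have nz: "G \<noteq> 0" "H \<noteq> 0" using gnz b T(4) by (auto simp: G_def H_def)
    have "V a y = (\<Prod>j\<in>S. y a - y j) * V (Suc a) y"
      unfolding V_def P_def by (subst prod_ordered_pairs_Suc) (simp add: S_def)
    also have "(\<Prod>j\<in>S. y a - y j) = (\<Prod>j\<in>S. x b - x (t j))"
      by (simp add: y_def ta)
    also have "\<dots> = R"
      unfolding R_def by (rule prod.reindex_bij_betw[OF bij])
    finally have Va: "V a y = R * V (Suc a) y" .
    \<comment> \<open>Antisymmetry absorbs the sign of \<open>t\<close>; with \<open>Va\<close>, the
      smaller Vandermonde product becomes the full one divided by \<open>R\<close>.\<close>
    have "of_int (sign t) * V a y = V a x"
    proof (cases "b = a")
      case True
      then show ?thesis by (simp add: t_def y_def)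
    next
      case False
      then have "a < b" "b \<le> k" using b by (auto simp: T_def)
      then have "V a y = - V a x"
        using vandermonde_transpose[of a a b k x] by (simp add: V_def P_def y_def t_def)
      then show ?thesis using False by (simp add: t_def sign_swap_id)
    qed
    then have V: "of_int (sign t) * V (Suc a) y = V a x / R"
      using Rnz by (simp add: Va field_simps)
    have D: "D T = (x b - 1 + \<rho> * (1 - p / q)) * D (T - {b})"
      unfolding D_def by (rule prod.remove[OF T(4) b])
    have Q: "Q T = G * H * Q (T - {b})"
      unfolding Q_def G_def H_def by (rule prod_offdiag_remove[OF T(4) b])
    have nz': "D (T - {b}) \<noteq> 0" "Q (T - {b}) \<noteq> 0" "x b - 1 + \<rho> * (1 - p / q) \<noteq> 0"
      using Dnz Qnz cnz[OF b] by auto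
    have "(\<Sum>\<sigma> | \<sigma> permutes S. F a x (t \<circ> \<sigma>))
      = of_int (sign t) / (G * \<Gamma>) * (q ^ e * V (Suc a) y / (D (T - {b}) * Q (T - {b})))"
      unfolding IH[symmetric] sum_distrib_left by (rule sum.cong) (simp_all add: summand')
    also have "\<dots> = q ^ e * (of_int (sign t) * V (Suc a) y) / (G * \<Gamma> * (D (T - {b}) * Q (T - {b})))"
      by simp
    also have "\<dots> = q ^ e * V a x / (\<Gamma> * D T * Q T) * ((x b - 1 + \<rho> * (1 - p / q)) * H / R)"
      unfolding V D Q using nz nz' by simp
    finally show ?thesis by (simp add: t_def H_def R_def g_def)
  qed

  have "(\<Sum>\<sigma> | \<sigma> permutes T. F a x \<sigma>)
    = (\<Sum>b\<in>T. \<Sum>\<sigma> | \<sigma> permutes S. F a x (transpose a b \<circ> \<sigma>))"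
    unfolding T(1) by (rule sum_over_permutations_insert[OF T(3,2)])
  also have "\<dots> = q ^ e * V a x / (\<Gamma> * D T * Q T)
    * (\<Sum>b\<in>T. (x b - 1 + \<rho> * (1 - p / q)) * (\<Prod>i\<in>T-{b}. p + q * x i * x b - x i) / (\<Prod>i\<in>T-{b}. x b - x i))"
    unfolding sum_distrib_left by (rule sum.cong) (simp_all only: summand)
  also have "(\<Sum>b\<in>T. (x b - 1 + \<rho> * (1 - p / q)) * (\<Prod>i\<in>T-{b}. p + q * x i * x b - x i) / (\<Prod>i\<in>T-{b}. x b - x i))
    = q ^ (card T - 1) * \<Gamma>"
    unfolding \<Gamma>_def using gnz unfolding g_def
    by (intro sum_interpolation_identity T(4,5) inj assms(1,2))
  also have "q ^ e * V a x / (\<Gamma> * D T * Q T) * (q ^ (card T - 1) * \<Gamma>)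
    = q ^ (e + (k - a)) * V a x / (D T * Q T)"
    using \<Gamma> by (simp add: cardT power_add)
  \<comment> \<open>With \<open>n = k - a\<close> this is \<open>n(n-1)/2 + n = (n+1)n/2\<close>;
    the case \<open>n = 0\<close> is separate because of truncated subtraction.\<close>
  also have "e + (k - a) = (Suc k - a) * (k - a) div 2"
  proof (cases "k - a")
    case (Suc n)
    then have "Suc k - a = Suc (Suc n)" "k - Suc a = n" by auto
    then have "(Suc k - a) * (k - a) = (k - a) * (k - Suc a) + (k - a) * 2"
      using Suc by (simp add: algebra_simps)
    then show ?thesis by (simp add: e_def)
  qed (use ak in \<open>simp add: e_def\<close>)
  finally show ?case
    by (simp add: F_def P_def V_def D_def Q_def T_def g_def)
qed

section \<open>Constants, variables and nonzero denominators in the field of rational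
  functions\<close>

lemma Fract_1_eq_0_iff: "Fract P 1 = 0 \<longleftrightarrow> P = (0 :: 'a::idom)"
  by (simp add: Zero_fract_def eq_fract)

lemma rconst_add: "rconst (a + b) = rconst a + rconst b"
  by (simp add: rconst_def Poly_Mapping.single_add)

lemma rconst_diff: "rconst (a - b) = rconst a - rconst b"
  by (simp add: rconst_def Poly_Mapping.single_diff)

lemma rconst_mult: "rconst (a * b) = rconst a * rconst b"
  by (simp add: rconst_def Poly_Mapping.mult_single)

lemma rconst_1: "rconst 1 = 1"
  by (simp add: rconst_def One_fract_def)

lemma rconst_power: "rconst (a ^ n) = rconst a ^ n"
  by (induction n) (simp_all add: rconst_1 rconst_mult)

lemma rconst_eq_0_iff: "rconst a = 0 \<longleftrightarrow> a = 0"
  unfolding rconst_def Fract_1_eq_0_iff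
  by (metis Poly_Mapping.lookup_single_eq Poly_Mapping.single_zero)

lemma rconst_divide: "b \<noteq> 0 \<Longrightarrow> rconst (a / b) = rconst a / rconst b"
  by (simp add: eq_divide_eq rconst_eq_0_iff flip: rconst_mult)

lemma inj_rvar: "inj rvar"
proof (rule injI)
  fix i j assume "rvar i = rvar j"
  then have "Poly_Mapping.single (Poly_Mapping.single i (1::nat)) (1::real)
    = Poly_Mapping.single (Poly_Mapping.single j 1) 1"
    by (simp add: rvar_def eq_fract)
  then have "Poly_Mapping.single i (1::nat) = Poly_Mapping.single j 1"
    by (metis Poly_Mapping.lookup_single_eq Poly_Mapping.lookup_single_not_eq zero_neq_one)
  then show "i = j"
    by (metis Poly_Mapping.lookup_single_eq Poly_Mapping.lookup_single_not_eq zero_neq_one)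
qed

lemma prod_rvar:
  assumes "finite A"
  shows "(\<Prod>i\<in>A. rvar i)
    = Fract (Poly_Mapping.single (\<Sum>i\<in>A. Poly_Mapping.single i (1::nat)) (1::real)) 1"
  using assms
  by (induction A rule: finite_induct) (simp_all add: rvar_def One_fract_def Poly_Mapping.mult_single)

text \<open>For nonempty \<open>A\<close> the product is a nonconstant monomial, so its coefficient
  1 survives the addition of a constant.\<close>

lemma prod_rvar_add_rconst_nonzero:
  assumes "finite A" "A \<noteq> {}"
  shows "(\<Prod>i\<in>A. rvar i) + rconst c \<noteq> 0"
proof -
  define s where "s = (\<Sum>i\<in>A. Poly_Mapping.single i (1::nat))"
  obtain a where a: "a \<in> A" using assms by blast
  have "Poly_Mapping.lookup s a = (\<Sum>i\<in>A. if i = a then 1 else 0)"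
    unfolding s_def Poly_Mapping.lookup_sum by (rule sum.cong) (auto simp: Poly_Mapping.lookup_single)
  also have "\<dots> = 1" using assms(1) a by simp
  finally have "s \<noteq> 0" by auto
  then have "Poly_Mapping.lookup (Poly_Mapping.single s (1::real) + Poly_Mapping.single 0 c) s \<noteq> 0"
    by (simp add: Poly_Mapping.lookup_add Poly_Mapping.lookup_single)
  then have "Poly_Mapping.single s (1::real) + Poly_Mapping.single 0 c \<noteq> 0"
    by (metis Poly_Mapping.lookup_zero)
  then show ?thesis
    by (simp add: prod_rvar[OF assms(1)] s_def rconst_def Fract_1_eq_0_iff)
qed

text \<open>The monomial in \<open>rvar i * rvar j\<close> has coefficient \<open>q\<close>. The
  case \<open>i = j\<close> is included because interpolation divides by the quadratic at its own
  nodes.\<close>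

lemma quadratic_factor_nonzero:
  assumes "q \<noteq> 0"
  shows "rconst p + rconst q * rvar i * rvar j - rvar i \<noteq> 0"
proof -
  define u v where "u = Poly_Mapping.single i (1::nat)" and "v = Poly_Mapping.single j (1::nat)"
  \<comment> \<open>This separates the exponent \<open>u + v\<close> from \<open>u\<close>; the next
    fact separates it from 0.\<close>
  have "v \<noteq> 0"
    unfolding v_def by (metis Poly_Mapping.lookup_single_eq Poly_Mapping.lookup_zero zero_neq_one)
  moreover have "u + v \<noteq> 0"
    by (auto simp: u_def Poly_Mapping.lookup_add dest!: arg_cong[of _ _ "\<lambda>f. Poly_Mapping.lookup f i"])
  ultimately have "Poly_Mapping.lookup (Poly_Mapping.single 0 p + Poly_Mapping.single (u + v) q
      - Poly_Mapping.single u 1) (u + v) \<noteq> 0"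
    using assms by (simp add: Poly_Mapping.lookup_add Poly_Mapping.lookup_minus Poly_Mapping.lookup_single)
  then have "Poly_Mapping.single 0 p + Poly_Mapping.single (u + v) q - Poly_Mapping.single u 1 \<noteq> 0"
    by (metis Poly_Mapping.lookup_zero)
  then show ?thesis
    by (simp add: rvar_def u_def v_def rconst_def Poly_Mapping.mult_single Fract_1_eq_0_iff)
qed

theorem mainTheorem4:
  fixes p q \<tau> \<rho> :: real and k :: nat and \<xi> :: "nat \<Rightarrow> rfun"
  assumes "p \<ge> 0" and "q \<ge> 0" and "p + q = 1" and "q \<noteq> 0"
    and "\<tau> = p / q"
    and "0 < \<rho>" and "\<rho> \<le> 1"
    and "k \<ge> 1"
    and "\<And>i. \<xi> i = rvar i"
  shows
    "(\<Sum>\<sigma> | \<sigma> permutes {1..k}.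
        of_int (sign \<sigma>)
        * (\<Prod>(i, j) \<in> {(i, j). 1 \<le> i \<and> i < j \<and> j \<le> k}.
             1 / (rconst p + rconst q * \<xi> (\<sigma> i) * \<xi> (\<sigma> j) - \<xi> (\<sigma> i)))
        * (\<Prod>i = 1..k.
             1 / ((\<Prod>l = i..k. \<xi> (\<sigma> l)) - 1 + rconst \<rho> - rconst (\<tau> ^ (k - i + 1) * \<rho>))))
     = rconst (q ^ (k * (k - 1) div 2))
       * (\<Prod>(i, j) \<in> {(i, j). 1 \<le> i \<and> i < j \<and> j \<le> k}. \<xi> i - \<xi> j)
       / ((\<Prod>i = 1..k. \<xi> i - 1 + rconst (\<rho> * (1 - \<tau>)))
          * (\<Prod>(i, j) \<in> {(i, j). i \<in> {1..k} \<and> j \<in> {1..k} \<and> i \<noteq> j}.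
               rconst p + rconst q * \<xi> i * \<xi> j - \<xi> i))"
proof -
  have \<tau>: "rconst \<tau> = rconst p / rconst q"
    using assms(4,5) by (simp add: rconst_divide)
  have \<xi>: "\<xi> = rvar" using assms(9) by auto
  have "(\<Prod>l\<in>A. \<xi> l) - 1 + rconst \<rho> - (rconst p / rconst q) ^ card A * rconst \<rho> \<noteq> 0"
    if "A \<subseteq> {1..k}" "A \<noteq> {}" for A
    \<comment> \<open>The chosen constant collects all terms of the denominator other than the
      monomial.\<close>
    using prod_rvar_add_rconst_nonzero[of A "\<rho> - 1 - \<tau> ^ card A * \<rho>"] that
    by (simp add: \<xi> finite_subset rconst_add rconst_diff rconst_1 rconst_mult rconst_power \<tau> algebra_simps)
  moreover have "rconst p + rconst q = 1"
    using assms(3) by (simp add: rconst_1 flip: rconst_add)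
  ultimately have "(\<Sum>\<sigma> | \<sigma> permutes {1..k}.
        of_int (sign \<sigma>)
        * (\<Prod>(i, j) \<in> {(i, j). 1 \<le> i \<and> i < j \<and> j \<le> k}.
             1 / (rconst p + rconst q * \<xi> (\<sigma> i) * \<xi> (\<sigma> j) - \<xi> (\<sigma> i)))
        * (\<Prod>i = 1..k. 1 / ((\<Prod>l = i..k. \<xi> (\<sigma> l)) - 1 + rconst \<rho>
             - (rconst p / rconst q) ^ (k - i + 1) * rconst \<rho>)))
     = rconst q ^ ((Suc k - 1) * (k - 1) div 2)
       * (\<Prod>(i, j) \<in> {(i, j). 1 \<le> i \<and> i < j \<and> j \<le> k}. \<xi> i - \<xi> j)
       / ((\<Prod>i = 1..k. \<xi> i - 1 + rconst \<rho> * (1 - rconst p / rconst q))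
          * (\<Prod>(i, j) \<in> {(i, j). i \<in> {1..k} \<and> j \<in> {1..k} \<and> i \<noteq> j}.
               rconst p + rconst q * \<xi> i * \<xi> j - \<xi> i))"
    using assms(4) quadratic_factor_nonzero inj_rvar
    by (intro antisymmetrized_product_identity) (auto simp: \<xi> rconst_eq_0_iff intro: inj_on_subset)
  then show ?thesis
    by (simp only: rconst_mult rconst_diff rconst_1 rconst_power \<tau> diff_Suc_1)
qed

end
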